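(* Let $V_1,\dots,V_N$ be irreducible finite-dimensional representations of $U_q(\widehat{\mathfrak g})$, $z_1,\dots,z_N$ spectral parameters, $u$ an element of the Cartan subgroup $H$, and let $$K_j(1)=R^{V_jV_{j-1}}_{j,j-1}(z_j/z_{j-1})\cdots R^{V_jV_1}_{j,1}(z_j/z_1)\,u_j\,R^{V_jV_N}_{j,N}(z_j/z_N)\cdots R^{V_jV_{j+1}}_{j,j+1}(z_j/z_{j+1})$$ be the operator on $V_N(z_N)\otimes\cdots\otimes V_1(z_1)$ obtained from the operator on the right-hand side of the $j$th qKZ equation in the critical level limit $p\to1$. Suppose that $V_j$ is such that, up to a scalar, $R^{V_jV_j}(1)=P$, the permutation operator $x\otimes y\mapsto y\otimes x$ on $V_j(z)\otimes V_j(z)$. Then $K_j(1)=t_{V_j}(z_j,u)$.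
   Context: $\mathfrak g$ is a simple Lie algebra, $U_q(\widehat{\mathfrak g})$ the quantum affine algebra, $q$ not a root of unity; $H$ is the Cartan subgroup of the simply-connected group of $\mathfrak g$. $V_i(z_i)$ is the shift of $V_i$ by the spectral parameter $z_i$. $R^{V_jV_i}_{j,i}(z_j/z_i)$ is the $R$-matrix acting on $V_j(z_j)\otimes V_i(z_i)$, normalized to act as the identity on $v_j\otimes v_i$, the tensor product of highest weight vectors; subscripts indicate the tensor factors on which it acts. $u_j=u|_{V_j}$. The $j$th qKZ equation with parameter $p$ reads $\Psi(z_1,\dots,pz_j,\dots,z_N)=R^{V_jV_{j-1}}_{j,j-1}(pz_j/z_{j-1})\cdots R^{V_jV_1}_{j,1}(pz_j/z_1)\,u_j\,R^{V_jV_N}_{j,N}(z_j/z_N)\cdots R^{V_jV_{j+1}}_{j,j+1}(z_j/z_{j+1})\Psi(z_1,\dots,z_N)$. For an auxiliary representation $V$ (tensor factor labeled $a$), the transfer-matrix acting on $V_N(z_N)\otimes\cdots\otimes V_1(z_1)$ is $t_V(z,u)=\operatorname{Tr}_a\big(u_a\,R^{VV_N}_{a,N}(z/z_N)\cdots R^{VV_1}_{a,1}(z/z_1)\big)$. The parameters $z_k$ are such that the $R$-matrices involved are defined. *)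

theory Defs
  imports
    Complex_Main
    "HOL-Computational_Algebra.Fraction_Field"
    "HOL-Computational_Algebra.Polynomial"
    "HOL-Library.FuncSet"
    "Jordan_Normal_Form.Matrix"
begin

section \<open>Simple Lie algebras and their affine root data\<close>

text \<open>
  A simple complex Lie algebra is given by its Cartan matrix
  \<open>cartan g i j = \<langle>\<alpha>\<^sub>j, \<alpha>\<^sub>i\<^sup>\<or>\<rangle>\<close>, with rows and columns indexed by \<open>1, \<dots>, rank g\<close>. Index \<open>0\<close>
  is reserved for the affine node.
\<close>

record cartan_datum =
  rank :: nat
  cartan :: "nat \<Rightarrow> nat \<Rightarrow> int"

definition symmetrizes :: "cartan_datum \<Rightarrow> (nat \<Rightarrow> nat) \<Rightarrow> bool" where
  "symmetrizes g d \<longleftrightarrow>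
     (\<forall>i\<in>{1..rank g}. d i > 0) \<and>
     (\<forall>i\<in>{1..rank g}. \<forall>j\<in>{1..rank g}. int (d i) * cartan g i j = int (d j) * cartan g j i)"

definition simple_lie :: "cartan_datum \<Rightarrow> bool" where
  "simple_lie g \<longleftrightarrow>
     rank g \<ge> 1 \<and>
     (\<forall>i\<in>{1..rank g}. cartan g i i = 2) \<and>
     (\<forall>i\<in>{1..rank g}. \<forall>j\<in>{1..rank g}. i \<noteq> j \<longrightarrow>
        cartan g i j \<le> 0 \<and> (cartan g i j = 0 \<longleftrightarrow> cartan g j i = 0)) \<and>
     (\<comment> \<open>finite type\<close>
      \<exists>d. symmetrizes g d \<and>
        (\<forall>x :: nat \<Rightarrow> real. (\<exists>i\<in>{1..rank g}. x i \<noteq> 0) \<longrightarrow>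
          (\<Sum>i=1..rank g. \<Sum>j=1..rank g. real (d i) * of_int (cartan g i j) * x i * x j) > 0)) \<and>
     (\<comment> \<open>indecomposable\<close>
      \<forall>J \<subseteq> {1..rank g}. J \<noteq> {} \<longrightarrow> J \<noteq> {1..rank g} \<longrightarrow>
        (\<exists>i\<in>J. \<exists>j\<in>{1..rank g} - J. cartan g i j \<noteq> 0))"

text \<open>The coprime symmetrizer: \<open>d\<^sub>i = (\<alpha>\<^sub>i,\<alpha>\<^sub>i)/2\<close>, where short roots have square length \<open>2\<close>.\<close>

definition symmetrizer :: "cartan_datum \<Rightarrow> nat \<Rightarrow> nat" where
  "symmetrizer g = (THE d. symmetrizes g d \<and> Gcd (d ` {1..rank g}) = 1 \<and>
     (\<forall>i. i \<notin> {1..rank g} \<longrightarrow> d i = 0))"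

text \<open>Roots are written in the basis of simple roots, and are the Weyl group images of the
  simple roots.\<close>

inductive_set roots :: "cartan_datum \<Rightarrow> (nat \<Rightarrow> int) set" for g where
  simple_root: "i \<in> {1..rank g} \<Longrightarrow> (\<lambda>k. if k = i then 1 else 0) \<in> roots g"
| reflection: "\<beta> \<in> roots g \<Longrightarrow> i \<in> {1..rank g} \<Longrightarrow>
    \<beta>(i := \<beta> i - (\<Sum>j=1..rank g. cartan g i j * \<beta> j)) \<in> roots g"

definition highest_root :: "cartan_datum \<Rightarrow> nat \<Rightarrow> int" where
  "highest_root g = (THE \<theta>. \<theta> \<in> roots g \<and> (\<forall>\<beta>\<in>roots g. \<forall>i. \<beta> i \<le> \<theta> i))"

text \<open>
  The untwisted affinization: \<open>\<alpha>\<^sub>0 = \<delta> - \<theta>\<close>, so that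
  \<open>d\<^sub>0 = (\<theta>,\<theta>)/2\<close>, \<open>a\<^sub>i\<^sub>0 = -\<langle>\<theta>, \<alpha>\<^sub>i\<^sup>\<or>\<rangle>\<close> and \<open>a\<^sub>0\<^sub>j = -2(\<theta>,\<alpha>\<^sub>j)/(\<theta>,\<theta>)\<close>. Both divisions below are exact.
\<close>

definition aff_symmetrizer :: "cartan_datum \<Rightarrow> nat \<Rightarrow> nat" where
  "aff_symmetrizer g i =
     (if i = 0 then
        nat ((\<Sum>k=1..rank g. \<Sum>l=1..rank g.
           highest_root g k * int (symmetrizer g k) * cartan g k l * highest_root g l) div 2)
      else symmetrizer g i)"

definition aff_cartan :: "cartan_datum \<Rightarrow> nat \<Rightarrow> nat \<Rightarrow> int" where
  "aff_cartan g i j =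
     (if i = 0 \<and> j = 0 then 2
      else if j = 0 then - (\<Sum>k=1..rank g. cartan g i k * highest_root g k)
      else if i = 0 then
        - ((\<Sum>k=1..rank g. highest_root g k * int (symmetrizer g k) * cartan g k j)
             div int (aff_symmetrizer g 0))
      else cartan g i j)"


section \<open>The quantum affine algebra and its finite-dimensional representations\<close>

datatype qgen = E nat | F nat | K nat | Kinv nat

text \<open>
  A matrix representation over a field \<open>'k\<close>: the dimension and the images of the Chevalley
  generators of the quantum affine algebra. As the algebra is presented by generators and
  relations, its representations on \<open>'k\<^sup>n\<close> are the choices of images satisfying the relations.
\<close>

record 'k qrep =
  rdim :: nat
  act :: "qgen \<Rightarrow> 'k mat"

definition qi :: "cartan_datum \<Rightarrow> complex \<Rightarrow> nat \<Rightarrow> complex" where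
  "qi g q i = q ^ aff_symmetrizer g i"

definition qint :: "complex \<Rightarrow> nat \<Rightarrow> complex" where
  "qint t n = (t ^ n - inverse t ^ n) / (t - inverse t)"

definition qfact :: "complex \<Rightarrow> nat \<Rightarrow> complex" where
  "qfact t n = (\<Prod>k=1..n. qint t k)"

definition qbinom :: "complex \<Rightarrow> nat \<Rightarrow> nat \<Rightarrow> complex" where
  "qbinom t n k = qfact t n / (qfact t k * qfact t (n - k))"

text \<open>The quantum Serre relation between \<open>X\<close> and \<open>Y\<close> with \<open>m = 1 - a\<^sub>i\<^sub>j\<close>, read entrywise.\<close>

definition qserre :: "nat \<Rightarrow> complex \<Rightarrow> nat \<Rightarrow> complex mat \<Rightarrow> complex mat \<Rightarrow> bool" where
  "qserre n t m X Y \<longleftrightarrow>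
     (\<forall>a<n. \<forall>b<n. (\<Sum>k\<le>m. (-1) ^ k * qbinom t m k *
        ((X ^\<^sub>m (m - k)) * Y * (X ^\<^sub>m k)) $$ (a, b)) = 0)"

definition is_rep :: "cartan_datum \<Rightarrow> complex \<Rightarrow> complex qrep \<Rightarrow> bool" where
  "is_rep g q V \<longleftrightarrow>
     (let n = rdim V; \<rho> = act V; I = {0..rank g} in
       (\<forall>i\<in>I. \<rho> (E i) \<in> carrier_mat n n \<and> \<rho> (F i) \<in> carrier_mat n n \<and>
              \<rho> (K i) \<in> carrier_mat n n \<and> \<rho> (Kinv i) \<in> carrier_mat n n) \<and>
       (\<forall>i\<in>I. \<rho> (K i) * \<rho> (Kinv i) = 1\<^sub>m n \<and> \<rho> (Kinv i) * \<rho> (K i) = 1\<^sub>m n) \<and>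
       (\<forall>i\<in>I. \<forall>j\<in>I. \<rho> (K i) * \<rho> (K j) = \<rho> (K j) * \<rho> (K i)) \<and>
       (\<forall>i\<in>I. \<forall>j\<in>I.
          \<rho> (K i) * \<rho> (E j) * \<rho> (Kinv i) = (qi g q i powi aff_cartan g i j) \<cdot>\<^sub>m \<rho> (E j) \<and>
          \<rho> (K i) * \<rho> (F j) * \<rho> (Kinv i) = (qi g q i powi (- aff_cartan g i j)) \<cdot>\<^sub>m \<rho> (F j)) \<and>
       (\<forall>i\<in>I. \<forall>j\<in>I.
          \<rho> (E i) * \<rho> (F j) - \<rho> (F j) * \<rho> (E i) =
            (if i = j then inverse (qi g q i - inverse (qi g q i)) \<cdot>\<^sub>m (\<rho> (K i) - \<rho> (Kinv i))
             else 0\<^sub>m n n)) \<and>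
       (\<forall>i\<in>I. \<forall>j\<in>I. i \<noteq> j \<longrightarrow>
          qserre n (qi g q i) (nat (1 - aff_cartan g i j)) (\<rho> (E i)) (\<rho> (E j)) \<and>
          qserre n (qi g q i) (nat (1 - aff_cartan g i j)) (\<rho> (F i)) (\<rho> (F j))))"

text \<open>
  Type 1: the \<open>K\<^sub>i\<close> are simultaneously diagonalizable with eigenvalues in \<open>q\<^sub>i\<^sup>\<int>\<close>. This is the usual
  standing convention, without which the weights do not lie in the weight lattice.
\<close>

definition type_one :: "cartan_datum \<Rightarrow> complex \<Rightarrow> complex qrep \<Rightarrow> bool" where
  "type_one g q V \<longleftrightarrow>
     (\<exists>S \<in> carrier_mat (rdim V) (rdim V). invertible_mat S \<and>
       (\<forall>c<rdim V. \<exists>m :: nat \<Rightarrow> int. \<forall>i\<in>{0..rank g}.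
          act V (K i) *\<^sub>v col S c = (qi g q i powi m i) \<cdot>\<^sub>v col S c))"

definition irreducible_rep :: "cartan_datum \<Rightarrow> complex \<Rightarrow> complex qrep \<Rightarrow> bool" where
  "irreducible_rep g q V \<longleftrightarrow>
     is_rep g q V \<and> type_one g q V \<and> rdim V > 0 \<and>
     (\<forall>W \<subseteq> carrier_vec (rdim V).
        0\<^sub>v (rdim V) \<in> W \<longrightarrow>
        (\<forall>x\<in>W. \<forall>y\<in>W. x + y \<in> W) \<longrightarrow>
        (\<forall>x\<in>W. \<forall>c. c \<cdot>\<^sub>v x \<in> W) \<longrightarrow>
        (\<forall>x\<in>W. \<forall>i\<in>{0..rank g}. \<forall>X\<in>{E i, F i, K i, Kinv i}. act V X *\<^sub>v x \<in> W) \<longrightarrow>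
        W = {0\<^sub>v (rdim V)} \<or> W = carrier_vec (rdim V))"


section \<open>Weights and the Cartan subgroup\<close>

text \<open>A weight is given by its values on the simple coroots \<open>\<alpha>\<^sub>1\<^sup>\<or>, \<dots>, \<alpha>\<^sub>r\<^sup>\<or>\<close>.\<close>

definition weight_lattice :: "cartan_datum \<Rightarrow> (nat \<Rightarrow> int) set" where
  "weight_lattice g = {lam. \<forall>i. i \<notin> {1..rank g} \<longrightarrow> lam i = 0}"

definition weight_vector ::
  "cartan_datum \<Rightarrow> complex \<Rightarrow> complex qrep \<Rightarrow> (nat \<Rightarrow> int) \<Rightarrow> complex vec \<Rightarrow> bool" where
  "weight_vector g q V lam x \<longleftrightarrow>
     lam \<in> weight_lattice g \<and> x \<in> carrier_vec (rdim V) \<and> x \<noteq> 0\<^sub>v (rdim V) \<and>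
     (\<forall>i\<in>{1..rank g}. act V (K i) *\<^sub>v x = (qi g q i powi lam i) \<cdot>\<^sub>v x)"

definition dominated :: "cartan_datum \<Rightarrow> (nat \<Rightarrow> int) \<Rightarrow> (nat \<Rightarrow> int) \<Rightarrow> bool" where
  "dominated g mu lam \<longleftrightarrow>
     (\<exists>n :: nat \<Rightarrow> nat. \<forall>i\<in>{1..rank g}.
        lam i - mu i = (\<Sum>j=1..rank g. int (n j) * cartan g i j))"

text \<open>A highest weight vector must have the highest weight: the weaker requirement to be killed
  by \<open>E\<^sub>1, \<dots>, E\<^sub>r\<close> does not determine a line in an irreducible representation of the affine algebra.\<close>

definition highest_weight_vector ::
  "cartan_datum \<Rightarrow> complex \<Rightarrow> complex qrep \<Rightarrow> complex vec \<Rightarrow> bool" where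
  "highest_weight_vector g q V v \<longleftrightarrow>
     (\<exists>lam. weight_vector g q V lam v \<and>
       (\<forall>mu x. weight_vector g q V mu x \<longrightarrow> dominated g mu lam))"

text \<open>
  The character lattice of the Cartan subgroup \<open>H\<close> of the simply-connected group is the whole
  weight lattice, and a torus is the group of homomorphisms from its character lattice to \<open>\<complex>\<^sup>*\<close>.
  An element \<open>u\<close> is thus identified with the map \<open>lam \<mapsto> lam(u)\<close>.
\<close>

definition cartan_subgroup :: "cartan_datum \<Rightarrow> ((nat \<Rightarrow> int) \<Rightarrow> complex) set" where
  "cartan_subgroup g =
     {u \<in> extensional (weight_lattice g).
        u (\<lambda>i. 0) = 1 \<and>
        (\<forall>lam\<in>weight_lattice g. \<forall>mu\<in>weight_lattice g. u (\<lambda>i. lam i + mu i) = u lam * u mu)}"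

text \<open>\<open>u|\<^sub>V\<close>; it exists and is unique because a type 1 representation is spanned by weight vectors.\<close>

definition cartan_action ::
  "cartan_datum \<Rightarrow> complex \<Rightarrow> ((nat \<Rightarrow> int) \<Rightarrow> complex) \<Rightarrow> complex qrep \<Rightarrow> complex mat" where
  "cartan_action g q u V =
     (THE U. U \<in> carrier_mat (rdim V) (rdim V) \<and>
        (\<forall>lam x. weight_vector g q V lam x \<longrightarrow> U *\<^sub>v x = u lam \<cdot>\<^sub>v x))"


section \<open>Shifts, coproduct and normalized R-matrices\<close>

definition kron :: "'k::comm_ring_1 mat \<Rightarrow> 'k mat \<Rightarrow> 'k mat" where
  "kron A B = mat (dim_row A * dim_row B) (dim_col A * dim_col B)
     (\<lambda>(a, b). A $$ (a div dim_row B, b div dim_col B) * B $$ (a mod dim_row B, b mod dim_col B))"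

definition kron_vec :: "'k::comm_ring_1 vec \<Rightarrow> 'k vec \<Rightarrow> 'k vec" where
  "kron_vec x y = vec (dim_vec x * dim_vec y) (\<lambda>a. x $ (a div dim_vec y) * y $ (a mod dim_vec y))"

text \<open>The permutation \<open>x \<otimes> y \<mapsto> y \<otimes> x\<close> on the tensor square of an \<open>n\<close>-dimensional space.\<close>

definition flip_mat :: "nat \<Rightarrow> complex mat" where
  "flip_mat n = mat (n * n) (n * n)
     (\<lambda>(a, b). if a div n = b mod n \<and> a mod n = b div n then 1 else 0)"

text \<open>\<open>V(z)\<close>, the pullback of \<open>V\<close> under \<open>E\<^sub>0 \<mapsto> z E\<^sub>0\<close>, \<open>F\<^sub>0 \<mapsto> z\<^sup>-\<^sup>1 F\<^sub>0\<close>.\<close>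

definition shift :: "'k::field \<Rightarrow> 'k qrep \<Rightarrow> 'k qrep" where
  "shift z V = V\<lparr>act := (\<lambda>X.
     if X = E 0 then z \<cdot>\<^sub>m act V X
     else if X = F 0 then inverse z \<cdot>\<^sub>m act V X
     else act V X)\<rparr>"

fun coproduct :: "'k::field qrep \<Rightarrow> 'k qrep \<Rightarrow> qgen \<Rightarrow> 'k mat" where
  "coproduct V W (E i) = kron (act V (E i)) (act W (K i)) + kron (1\<^sub>m (rdim V)) (act W (E i))"
| "coproduct V W (F i) = kron (act V (F i)) (1\<^sub>m (rdim W)) + kron (act V (Kinv i)) (act W (F i))"
| "coproduct V W (K i) = kron (act V (K i)) (act W (K i))"
| "coproduct V W (Kinv i) = kron (act V (Kinv i)) (act W (Kinv i))"

fun coproduct_op :: "'k::field qrep \<Rightarrow> 'k qrep \<Rightarrow> qgen \<Rightarrow> 'k mat" where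
  "coproduct_op V W (E i) = kron (act V (K i)) (act W (E i)) + kron (act V (E i)) (1\<^sub>m (rdim W))"
| "coproduct_op V W (F i) = kron (1\<^sub>m (rdim V)) (act W (F i)) + kron (act V (F i)) (act W (Kinv i))"
| "coproduct_op V W (K i) = kron (act V (K i)) (act W (K i))"
| "coproduct_op V W (Kinv i) = kron (act V (Kinv i)) (act W (Kinv i))"

type_synonym ratfun = "complex poly fract"

definition rat_const :: "complex \<Rightarrow> ratfun" where
  "rat_const c = Fraction_Field.Fract [:c:] 1"

definition rat_var :: ratfun where
  "rat_var = Fraction_Field.Fract [:0, 1:] 1"

definition base_change :: "complex qrep \<Rightarrow> ratfun qrep" where
  "base_change V = \<lparr>rdim = rdim V, act = (\<lambda>X. map_mat rat_const (act V X))\<rparr>"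

text \<open>
  \<open>R\<^sup>V\<^sup>W(z)\<close> as a matrix of rational functions of \<open>z\<close>: it intertwines the coproduct and the opposite
  coproduct on \<open>V(z) \<otimes> W\<close>, and fixes the tensor product of the highest weight vectors. Since
  \<open>V(z) \<otimes> W\<close> is irreducible over \<open>\<complex>(z)\<close>, these conditions characterize it. On \<open>V(x) \<otimes> W(y)\<close> the
  R-matrix is \<open>R\<^sup>V\<^sup>W(x/y)\<close>.
\<close>

definition normalized_R_matrix ::
  "cartan_datum \<Rightarrow> complex qrep \<Rightarrow> complex vec \<Rightarrow> complex qrep \<Rightarrow> complex vec \<Rightarrow>
   ratfun mat \<Rightarrow> bool" where
  "normalized_R_matrix g V v W w R \<longleftrightarrow>
     R \<in> carrier_mat (rdim V * rdim W) (rdim V * rdim W) \<and>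
     (\<forall>i\<in>{0..rank g}. \<forall>X\<in>{E i, F i, K i, Kinv i}.
        R * coproduct (shift rat_var (base_change V)) (base_change W) X =
        coproduct_op (shift rat_var (base_change V)) (base_change W) X * R) \<and>
     R *\<^sub>v map_vec rat_const (kron_vec v w) = map_vec rat_const (kron_vec v w)"

definition regular_at :: "ratfun mat \<Rightarrow> complex \<Rightarrow> bool" where
  "regular_at R z \<longleftrightarrow>
     (\<forall>a<dim_row R. \<forall>b<dim_col R. \<exists>n d. poly d z \<noteq> 0 \<and> R $$ (a, b) = Fraction_Field.Fract n d)"

text \<open>Meaningful only at points where \<open>f\<close> has no pole.\<close>

definition rat_value :: "ratfun \<Rightarrow> complex \<Rightarrow> complex" where
  "rat_value f z = (THE c. \<exists>n d. poly d z \<noteq> 0 \<and> f = Fraction_Field.Fract n d \<and> c = poly n z / poly d z)"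

definition value_at :: "ratfun mat \<Rightarrow> complex \<Rightarrow> complex mat" where
  "value_at R z = map_mat (\<lambda>f. rat_value f z) R"


section \<open>Operators on labelled tensor products\<close>

text \<open>
  The tensor product over \<open>k \<in> S\<close> of spaces of dimension \<open>d k\<close> has a basis indexed by the
  multi-indices in \<open>multi S d\<close>; an operator on it is the function of (row, column) giving its
  matrix, extended by \<open>0\<close>. The factors are told apart by their labels, so that no ordering of them
  enters. The tensor product of \<open>V\<^sub>N, \<dots>, V\<^sub>1\<close> has labels \<open>{1..N}\<close>; label \<open>0\<close> is the auxiliary factor \<open>a\<close>.
\<close>

type_synonym tensor_op = "(nat \<Rightarrow> nat) \<Rightarrow> (nat \<Rightarrow> nat) \<Rightarrow> complex"

definition multi :: "nat set \<Rightarrow> (nat \<Rightarrow> nat) \<Rightarrow> (nat \<Rightarrow> nat) set" where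
  "multi S d = (\<Pi>\<^sub>E k\<in>S. {..<d k})"

definition op_id :: "nat set \<Rightarrow> (nat \<Rightarrow> nat) \<Rightarrow> tensor_op" where
  "op_id S d x y = (if x \<in> multi S d \<and> x = y then 1 else 0)"

definition op_comp :: "nat set \<Rightarrow> (nat \<Rightarrow> nat) \<Rightarrow> tensor_op \<Rightarrow> tensor_op \<Rightarrow> tensor_op" where
  "op_comp S d A B x y = (\<Sum>w\<in>multi S d. A x w * B w y)"

text \<open>\<open>op_prod S d [A\<^sub>1, \<dots>, A\<^sub>m] = A\<^sub>1 \<cdots> A\<^sub>m\<close>\<close>

definition op_prod :: "nat set \<Rightarrow> (nat \<Rightarrow> nat) \<Rightarrow> tensor_op list \<Rightarrow> tensor_op" where
  "op_prod S d As = foldr (op_comp S d) As (op_id S d)"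

definition on_factor :: "nat set \<Rightarrow> (nat \<Rightarrow> nat) \<Rightarrow> nat \<Rightarrow> complex mat \<Rightarrow> tensor_op" where
  "on_factor S d k M x y =
     (if x \<in> multi S d \<and> y \<in> multi S d \<and> (\<forall>s\<in>S - {k}. x s = y s)
      then M $$ (x k, y k) else 0)"

text \<open>The first tensor factor of the matrix \<open>M\<close> acts in factor \<open>k\<close> and the second in factor \<open>l \<noteq> k\<close>;
  the index convention is that of \<^const>\<open>kron\<close>.\<close>

definition on_factors :: "nat set \<Rightarrow> (nat \<Rightarrow> nat) \<Rightarrow> nat \<Rightarrow> nat \<Rightarrow> complex mat \<Rightarrow> tensor_op" where
  "on_factors S d k l M x y =
     (if x \<in> multi S d \<and> y \<in> multi S d \<and> (\<forall>s\<in>S - {k, l}. x s = y s)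
      then M $$ (x k * d l + x l, y k * d l + y l) else 0)"

definition partial_trace :: "nat set \<Rightarrow> (nat \<Rightarrow> nat) \<Rightarrow> nat \<Rightarrow> tensor_op \<Rightarrow> tensor_op" where
  "partial_trace S d k A x y =
     (if x \<in> multi (S - {k}) d \<and> y \<in> multi (S - {k}) d
      then \<Sum>c<d k. A (x(k := c)) (y(k := c)) else 0)"


section \<open>The qKZ operators and the transfer-matrix\<close>

text \<open>In both definitions \<open>R\<close> is the family of R-matrices, \<open>R V W\<close> being \<open>R\<^sup>V\<^sup>W\<close>.\<close>

definition qKZ_operator ::
  "cartan_datum \<Rightarrow> complex \<Rightarrow> (complex qrep \<Rightarrow> complex qrep \<Rightarrow> ratfun mat) \<Rightarrow>
   nat \<Rightarrow> (nat \<Rightarrow> complex qrep) \<Rightarrow> (nat \<Rightarrow> complex) \<Rightarrow>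
   ((nat \<Rightarrow> int) \<Rightarrow> complex) \<Rightarrow> nat \<Rightarrow> complex \<Rightarrow> tensor_op" where
  "qKZ_operator g q R N V z u j p =
     (let S = {1..N}; d = (\<lambda>k. rdim (V k));
          Rj = (\<lambda>i x. on_factors S d j i (value_at (R (V j) (V i)) x))
      in op_prod S d
           (map (\<lambda>i. Rj i (p * z j / z i)) (rev [1..<j])
            @ [on_factor S d j (cartan_action g q u (V j))]
            @ map (\<lambda>i. Rj i (z j / z i)) (rev [Suc j..<Suc N])))"

definition transfer_matrix ::
  "cartan_datum \<Rightarrow> complex \<Rightarrow> (complex qrep \<Rightarrow> complex qrep \<Rightarrow> ratfun mat) \<Rightarrow>
   nat \<Rightarrow> (nat \<Rightarrow> complex qrep) \<Rightarrow> (nat \<Rightarrow> complex) \<Rightarrow>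
   complex qrep \<Rightarrow> complex \<Rightarrow> ((nat \<Rightarrow> int) \<Rightarrow> complex) \<Rightarrow> tensor_op" where
  "transfer_matrix g q R N V z A x u =
     (let S = {0..N}; d = (\<lambda>k. rdim (V k))(0 := rdim A)
      in partial_trace S d 0 (op_prod S d
           (on_factor S d 0 (cartan_action g q u A)
            # map (\<lambda>i. on_factors S d 0 i (value_at (R A (V i)) (x / z i))) (rev [1..<Suc N]))))"

end

(* With P the permutation of the auxiliary factor a and factor j, normalization gives
   R_{a,j}(1) = P. Moving P through the product relabels a as j:
   u_a R_{a,N} .. R_{a,j+1} P R_{a,j-1} .. R_{a,1}
     = (R_{j,j-1} .. R_{j,1}) P (u_j R_{j,N} .. R_{j,j+1}),
   because R_{j,i} for i < j commutes with u_a and R_{a,k} for k > j. The outer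
   factors do not involve a, and the partial trace of P over a is the identity. *)
theory Submission
  imports Defs "HOL-Combinatorics.Transposition"
begin

section \<open>Operators on labelled tensor products\<close>

text \<open>The claim equates an operator on the factors \<open>S\<close> with a trace of an
  operator on \<open>insert a S\<close>, and operators are bare functions of two multi-indices.
  \<open>lift_op\<close> embeds the first kind into the second by acting as the identity in
  \<open>a\<close>. Relabelling \<open>a\<close> as \<open>j\<close> is \<open>swap_op\<close>,
  conjugation by the transposition of two labels. Both maps respect products, and on the factors at
  hand the swapped operators are exactly the lifted ones, so the trace meets the permutation between
  two lifts. The value R(1) is given only up to a scalar, while the normalization is an identity
  over the rational functions. It must be evaluated at 1 before the two can be compared; regularity
  makes evaluation additive and multiplicative on the entries involved.\<close>

text \<open>A \<open>tensor_op\<close> is a total function, so the unit laws, and equality tested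
  only on multi-indices, hold just for operators that vanish elsewhere.\<close>

definition supported :: "nat set \<Rightarrow> (nat \<Rightarrow> nat) \<Rightarrow> tensor_op \<Rightarrow> bool" where
  "supported S d A \<longleftrightarrow> (\<forall>x y. A x y \<noteq> 0 \<longrightarrow> x \<in> multi S d \<and> y \<in> multi S d)"

lemma finite_multi: "finite S \<Longrightarrow> finite (multi S d)"
  unfolding multi_def by (intro finite_PiE) auto

lemma multi_cong: "(\<And>k. k \<in> S \<Longrightarrow> d k = d' k) \<Longrightarrow> multi S d = multi S d'"
  unfolding multi_def by (intro PiE_cong) auto

text \<open>The transfer-matrix and the qKZ operator carry dimension functions that may differ at
  label 0. This and the next two lemmas remove the difference over \<open>{1..N}\<close>.\<close>

lemma op_prod_dim_cong:
  assumes "\<And>k. k \<in> S \<Longrightarrow> d k = d' k"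
  shows "op_prod S d = op_prod S d'"
proof -
  have multi: "multi S d = multi S d'"
    using assms by (rule multi_cong)
  show ?thesis
    unfolding op_prod_def op_comp_def op_id_def multi by (rule refl)
qed

lemma on_factor_dim_cong:
  assumes "\<And>k. k \<in> S \<Longrightarrow> d k = d' k"
  shows "on_factor S d = on_factor S d'"
proof -
  have multi: "multi S d = multi S d'"
    using assms by (rule multi_cong)
  show ?thesis
    unfolding on_factor_def multi by (rule refl)
qed

text \<open>The number \<open>d l\<close> enters the index formula directly and not only through
  \<open>multi\<close>, hence the premise \<open>l \<in> S\<close>.\<close>

lemma on_factors_dim_cong:
  assumes "\<And>k. k \<in> S \<Longrightarrow> d k = d' k" "l \<in> S"
  shows "on_factors S d k l = on_factors S d' k l"
proof -
  have multi: "multi S d = multi S d'"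
    using assms(1) by (rule multi_cong)
  show ?thesis
    unfolding on_factors_def multi assms(1)[OF assms(2)] by (rule refl)
qed

lemma multi_eqI:
  "x \<in> multi S d \<Longrightarrow> y \<in> multi S d \<Longrightarrow> (\<And>s. s \<in> S \<Longrightarrow> x s = y s) \<Longrightarrow> x = y"
  unfolding multi_def by (rule PiE_ext) auto

lemma supported_eqI:
  assumes "supported S d A" "supported S d B"
    and "\<And>x y. x \<in> multi S d \<Longrightarrow> y \<in> multi S d \<Longrightarrow> A x y = B x y"
  shows "A = B"
proof (intro ext)
  fix x y
  show "A x y = B x y"
    using assms unfolding supported_def by (cases "x \<in> multi S d \<and> y \<in> multi S d") metis+
qed

lemma supported_id: "supported S d (op_id S d)"
  by (auto simp: supported_def op_id_def)

lemma supported_on_factor: "supported S d (on_factor S d k M)"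
  by (auto simp: supported_def on_factor_def)

lemma supported_on_factors: "supported S d (on_factors S d k l M)"
  by (auto simp: supported_def on_factors_def)

lemma supported_comp:
  assumes "supported S d A" "supported S d B"
  shows "supported S d (op_comp S d A B)"
  unfolding supported_def op_comp_def
proof (intro allI impI)
  fix x y
  assume "(\<Sum>w\<in>multi S d. A x w * B w y) \<noteq> 0"
  then obtain w where "A x w * B w y \<noteq> 0"
    by (meson sum.not_neutral_contains_not_neutral)
  then show "x \<in> multi S d \<and> y \<in> multi S d"
    using assms unfolding supported_def by auto
qed

lemma op_comp_assoc:
  "op_comp S d (op_comp S d A B) C = op_comp S d A (op_comp S d B C)"
  unfolding op_comp_def
  by (intro ext) (simp add: sum_distrib_left sum_distrib_right mult.assoc, rule sum.swap)

lemma op_comp_id_left: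
  assumes "finite S" "supported S d A"
  shows "op_comp S d (op_id S d) A = A"
proof (intro ext)
  fix x y
  have "op_comp S d (op_id S d) A x y = (\<Sum>w\<in>multi S d. if w = x then A x y else 0)"
    unfolding op_comp_def op_id_def by (intro sum.cong) auto
  also have "\<dots> = A x y"
    using assms by (auto simp: finite_multi supported_def)
  finally show "op_comp S d (op_id S d) A x y = A x y" .
qed

lemma op_comp_id_right:
  assumes "finite S" "supported S d A"
  shows "op_comp S d A (op_id S d) = A"
proof (intro ext)
  fix x y
  have "op_comp S d A (op_id S d) x y = (\<Sum>w\<in>multi S d. if w = y then A x y else 0)"
    unfolding op_comp_def op_id_def by (intro sum.cong) auto
  also have "\<dots> = A x y"
    using assms by (auto simp: finite_multi supported_def)
  finally show "op_comp S d A (op_id S d) x y = A x y" .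
qed

lemma op_prod_Nil: "op_prod S d [] = op_id S d"
  and op_prod_Cons: "op_prod S d (A # As) = op_comp S d A (op_prod S d As)"
  by (simp_all add: op_prod_def)

lemma supported_prod:
  "(\<And>A. A \<in> set As \<Longrightarrow> supported S d A) \<Longrightarrow> supported S d (op_prod S d As)"
  by (induction As) (auto simp: op_prod_Nil op_prod_Cons intro: supported_id supported_comp)

lemma op_prod_append:
  assumes "finite S" "\<And>B. B \<in> set Bs \<Longrightarrow> supported S d B"
  shows "op_prod S d (As @ Bs) = op_comp S d (op_prod S d As) (op_prod S d Bs)"
  by (induction As)
    (simp_all add: op_prod_Nil op_prod_Cons op_comp_assoc op_comp_id_left assms supported_prod)

text \<open>Commutation is asked only between a member of \<open>As\<close> and a member of
  \<open>Bs\<close>: operators within one list share a factor, and their order is preserved.\<close>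

lemma op_prod_commute:
  assumes "finite S"
    and "\<And>A. A \<in> set As \<Longrightarrow> supported S d A" "\<And>B. B \<in> set Bs \<Longrightarrow> supported S d B"
    and "\<And>A B. A \<in> set As \<Longrightarrow> B \<in> set Bs \<Longrightarrow> op_comp S d A B = op_comp S d B A"
  shows "op_comp S d (op_prod S d As) (op_prod S d Bs) =
         op_comp S d (op_prod S d Bs) (op_prod S d As)"
proof -
  have one: "op_comp S d A (op_prod S d Bs) = op_comp S d (op_prod S d Bs) A"
    if A: "supported S d A" "\<And>B. B \<in> set Bs \<Longrightarrow> op_comp S d A B = op_comp S d B A" for A
    using A(2)
  proof (induction Bs)
    case Nil
    then show ?case
      by (simp add: op_prod_Nil op_comp_id_left op_comp_id_right assms(1) A(1))
  next
    case (Cons B Bs)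
    have "op_comp S d A B = op_comp S d B A"
      "op_comp S d A (op_prod S d Bs) = op_comp S d (op_prod S d Bs) A"
      using Cons by simp_all
    then show ?case
      unfolding op_prod_Cons by (metis op_comp_assoc)
  qed
  show ?thesis
    using assms(2,4)
  proof (induction As)
    case Nil
    then show ?case
      by (simp add: op_prod_Nil op_comp_id_left op_comp_id_right assms(1,3) supported_prod)
  next
    case (Cons A As)
    have "op_comp S d A (op_prod S d Bs) = op_comp S d (op_prod S d Bs) A"
      by (rule one) (auto intro: Cons.prems)
    moreover have "op_comp S d (op_prod S d As) (op_prod S d Bs) =
        op_comp S d (op_prod S d Bs) (op_prod S d As)"
      by (rule Cons.IH) (auto intro: Cons.prems)
    ultimately show ?case
      unfolding op_prod_Cons by (metis op_comp_assoc)
  qed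
qed

text \<open>Source and target label sets are separate so that the lemma covers both the exchange of
  two labels and the adjunction of a new one.\<close>

lemma op_prod_map_hom:
  assumes "\<And>A. A \<in> set As \<Longrightarrow> supported S d A"
    and "h (op_id S d) = op_id T e"
    and "\<And>A B. supported S d A \<Longrightarrow> supported S d B \<Longrightarrow>
           h (op_comp S d A B) = op_comp T e (h A) (h B)"
  shows "h (op_prod S d As) = op_prod T e (map h As)"
  using assms(1)
  by (induction As) (simp_all add: op_prod_Nil op_prod_Cons assms(2,3) supported_prod)

section \<open>Operators on disjoint sets of factors commute\<close>

text \<open>This says that \<open>A\<close> is a \<otimes> id with \<open>a\<close> acting in the
  factors \<open>U\<close>. The kernel \<open>a\<close> takes full multi-indices and ignores the
  labels outside \<open>U\<close>, which avoids restricting them.\<close>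

definition local_op ::
  "nat set \<Rightarrow> (nat \<Rightarrow> nat) \<Rightarrow> nat set \<Rightarrow> tensor_op \<Rightarrow> tensor_op \<Rightarrow> bool" where
  "local_op S d U a A \<longleftrightarrow>
     (\<forall>x y x' y'. (\<forall>s\<in>U. x s = x' s \<and> y s = y' s) \<longrightarrow> a x y = a x' y') \<and>
     (\<forall>x y. A x y = (if x \<in> multi S d \<and> y \<in> multi S d \<and> (\<forall>s\<in>S - U. x s = y s)
                     then a x y else 0))"

lemma local_op_cong:
  "local_op S d U a A \<Longrightarrow> (\<And>s. s \<in> U \<Longrightarrow> x s = x' s \<and> y s = y' s) \<Longrightarrow> a x y = a x' y'"
  unfolding local_op_def by metis

lemma local_op_eq:
  "local_op S d U a A \<Longrightarrow> A x y =
     (if x \<in> multi S d \<and> y \<in> multi S d \<and> (\<forall>s\<in>S - U. x s = y s) then a x y else 0)"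
  unfolding local_op_def by metis

lemma local_on_factor:
  "local_op S d {k} (\<lambda>x y. M $$ (x k, y k)) (on_factor S d k M)"
  by (simp add: local_op_def on_factor_def)

lemma local_on_factors:
  "local_op S d {k, l} (\<lambda>x y. M $$ (x k * d l + x l, y k * d l + y l)) (on_factors S d k l M)"
  by (simp add: local_op_def on_factors_def)

text \<open>Only one intermediate multi-index can contribute to the product, and the resulting entry
  is symmetric in the two operators. Commutation follows from this symmetry.\<close>

lemma local_comp_eq:
  assumes "finite S" "U \<subseteq> S" "U \<inter> W = {}"
    and A: "local_op S d U a A" and B: "local_op S d W b B"
    and x: "x \<in> multi S d" and y: "y \<in> multi S d"
  shows "op_comp S d A B x y = (if \<forall>s\<in>S - (U \<union> W). x s = y s then a x y * b x y else 0)"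
proof -
  \<comment> \<open>A nonzero \<open>A x w\<close> forces \<open>w = x\<close> off \<open>U\<close>,
    and a nonzero \<open>B w y\<close> forces \<open>w = y\<close> off \<open>W\<close>, in
    particular on \<open>U\<close>.\<close>
  define m where "m = (\<lambda>s. if s \<in> U then y s else x s)"
  let ?r = "if \<forall>s\<in>S - (U \<union> W). x s = y s then a x y * b x y else 0"
  have m: "m \<in> multi S d"
    using x y assms(2) by (auto simp: m_def multi_def PiE_iff extensional_def)
  have at_m: "A x m * B m y = ?r"
  proof -
    have "a x m = a x y"
      by (rule local_op_cong[OF A]) (simp add: m_def)
    moreover have "b m y = b x y"
      by (rule local_op_cong[OF B]) (use assms(3) in \<open>auto simp: m_def\<close>)
    moreover have "\<forall>s\<in>S - U. x s = m s"
      by (simp add: m_def)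
    moreover have "(\<forall>s\<in>S - W. m s = y s) \<longleftrightarrow> (\<forall>s\<in>S - (U \<union> W). x s = y s)"
      by (auto simp: m_def)
    ultimately show ?thesis
      using x y m by (simp add: local_op_eq[OF A] local_op_eq[OF B])
  qed
  have off_m: "A x w * B w y = 0" if w: "w \<in> multi S d" "w \<noteq> m" for w
  proof (rule ccontr)
    assume "A x w * B w y \<noteq> 0"
    then have "A x w \<noteq> 0" "B w y \<noteq> 0" by auto
    then have eqs: "\<forall>s\<in>S - U. x s = w s" "\<forall>s\<in>S - W. w s = y s"
      by (simp_all add: local_op_eq[OF A] local_op_eq[OF B] split: if_splits)
    have "w = m"
    proof (rule multi_eqI[OF w(1) m])
      fix s assume "s \<in> S"
      then show "w s = m s"
        using eqs assms(3) by (cases "s \<in> U") (auto simp: m_def)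
    qed
    with w show False by simp
  qed
  have "op_comp S d A B x y = (\<Sum>w\<in>multi S d. if w = m then ?r else 0)"
    unfolding op_comp_def by (intro sum.cong refl) (metis at_m off_m)
  also have "\<dots> = ?r"
    using m finite_multi[OF assms(1)] by simp
  finally show ?thesis .
qed

lemma local_commute:
  assumes "finite S" "U \<subseteq> S" "W \<subseteq> S" "U \<inter> W = {}"
    and A: "local_op S d U a A" and B: "local_op S d W b B"
  shows "op_comp S d A B = op_comp S d B A"
proof (rule supported_eqI)
  show "supported S d (op_comp S d A B)" "supported S d (op_comp S d B A)"
    by (intro supported_comp; simp add: supported_def local_op_eq[OF A] local_op_eq[OF B])+
next
  fix x y
  assume xy: "x \<in> multi S d" "y \<in> multi S d"
  have "W \<inter> U = {}" using assms(4) by auto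
  then show "op_comp S d A B x y = op_comp S d B A x y"
    using local_comp_eq[OF assms(1,2,4) A B xy] local_comp_eq[OF assms(1,3) _ B A xy]
    by (simp add: Un_commute mult.commute)
qed

section \<open>Exchanging two factors\<close>

text \<open>For \<open>d k = d l\<close> this is P A P, where P exchanges the factors
  \<open>k\<close> and \<open>l\<close>.\<close>

definition swap_op :: "nat \<Rightarrow> nat \<Rightarrow> tensor_op \<Rightarrow> tensor_op" where
  "swap_op k l A x y = A (x \<circ> transpose k l) (y \<circ> transpose k l)"

lemma multi_transpose_iff:
  assumes "k \<in> S" "l \<in> S" "d k = d l"
  shows "x \<circ> transpose k l \<in> multi S d \<longleftrightarrow> x \<in> multi S d"
proof -
  have *: "x \<circ> transpose k l \<in> multi S d" if "x \<in> multi S d" for x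
    using that assms
    by (auto simp: multi_def PiE_iff extensional_def transpose_def)
  show ?thesis
    using *[of x] *[of "x \<circ> transpose k l"] by (auto simp: comp_assoc)
qed

lemma swap_op_swap_op: "swap_op k l (swap_op k l A) = A"
  by (intro ext) (simp add: swap_op_def comp_assoc)

lemma supported_swap_op:
  "k \<in> S \<Longrightarrow> l \<in> S \<Longrightarrow> d k = d l \<Longrightarrow> supported S d A \<Longrightarrow> supported S d (swap_op k l A)"
  unfolding supported_def swap_op_def using multi_transpose_iff by blast

lemma comp_transpose_eq_iff: "x \<circ> transpose k l = y \<longleftrightarrow> x = y \<circ> transpose k l"
  by (auto simp: comp_assoc)

lemma swap_op_id:
  "k \<in> S \<Longrightarrow> l \<in> S \<Longrightarrow> d k = d l \<Longrightarrow> swap_op k l (op_id S d) = op_id S d"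
  by (intro ext)
    (simp add: swap_op_def op_id_def multi_transpose_iff comp_transpose_eq_iff comp_assoc)

lemma swap_op_comp:
  assumes "k \<in> S" "l \<in> S" "d k = d l"
  shows "swap_op k l (op_comp S d A B) = op_comp S d (swap_op k l A) (swap_op k l B)"
proof (intro ext)
  fix x y
  have "bij_betw (\<lambda>w. w \<circ> transpose k l) (multi S d) (multi S d)"
    by (rule bij_betwI[where g = "\<lambda>w. w \<circ> transpose k l"])
      (use assms in \<open>auto simp: multi_transpose_iff comp_assoc\<close>)
  from sum.reindex_bij_betw[OF this, of "\<lambda>w. A (x \<circ> transpose k l) w * B w (y \<circ> transpose k l)"]
  show "swap_op k l (op_comp S d A B) x y = op_comp S d (swap_op k l A) (swap_op k l B) x y"
    unfolding swap_op_def op_comp_def by simp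
qed

text \<open>Reindexing for quantifiers. In the two relabelling lemmas below, the exempted labels are
  first expressed through \<open>transpose k l s\<close>, so that the whole condition is a predicate
  of that label.\<close>

lemma ball_transpose:
  assumes "k \<in> S" "l \<in> S"
  shows "(\<forall>s\<in>S. P (transpose k l s)) \<longleftrightarrow> (\<forall>s\<in>S. P s)"
  using assms by (auto simp: transpose_def)

lemma swap_on_factor:
  assumes "k \<in> S" "l \<in> S" "d k = d l"
  shows "swap_op k l (on_factor S d k M) = on_factor S d l M"
proof (intro ext)
  fix x y :: "nat \<Rightarrow> nat"
  have "(\<forall>s\<in>S - {k}. (x \<circ> transpose k l) s = (y \<circ> transpose k l) s) \<longleftrightarrow>
        (\<forall>s\<in>S. transpose k l s = l \<or> x (transpose k l s) = y (transpose k l s))"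
    by (auto simp: transpose_def)
  also have "\<dots> \<longleftrightarrow> (\<forall>s\<in>S - {l}. x s = y s)"
    using ball_transpose[OF assms(1,2), of "\<lambda>t. t = l \<or> x t = y t"] by auto
  finally show "swap_op k l (on_factor S d k M) x y = on_factor S d l M x y"
    unfolding swap_op_def on_factor_def multi_transpose_iff[of k S l d, OF assms] by simp
qed

lemma swap_on_factors:
  assumes "k \<in> S" "l \<in> S" "d k = d l" "i \<noteq> k" "i \<noteq> l"
  shows "swap_op k l (on_factors S d k i M) = on_factors S d l i M"
proof (intro ext)
  fix x y :: "nat \<Rightarrow> nat"
  have "transpose k l s = l \<longleftrightarrow> s = k" "transpose k l s = i \<longleftrightarrow> s = i" for s
    using assms(4,5) by (auto simp: transpose_def)
  then have "(\<forall>s\<in>S - {k, i}. (x \<circ> transpose k l) s = (y \<circ> transpose k l) s) \<longleftrightarrow>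
        (\<forall>s\<in>S. transpose k l s = l \<or> transpose k l s = i \<or>
                x (transpose k l s) = y (transpose k l s))"
    unfolding comp_apply by blast
  also have "\<dots> \<longleftrightarrow> (\<forall>s\<in>S - {l, i}. x s = y s)"
    using ball_transpose[OF assms(1,2), of "\<lambda>t. t = l \<or> t = i \<or> x t = y t"] by auto
  finally show "swap_op k l (on_factors S d k i M) x y = on_factors S d l i M x y"
    unfolding swap_op_def on_factors_def multi_transpose_iff[of k S l d, OF assms(1-3)]
    using assms by simp
qed

section \<open>The permutation operator as a relabelling of multi-indices\<close>

lemma flip_mat_entry:
  assumes "a < n" "b < n" "a' < n" "b' < n"
  shows "flip_mat n $$ (a * n + b, a' * n + b') = (if a = b' \<and> b = a' then 1 else 0)"
proof -
  \<comment> \<open>The estimate is \<open>p * n + r < Suc p * n \<le> n * n\<close>; it places both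
    indices inside the matrix.\<close>
  have bound: "p * n + r < n * n" if "p < n" "r < n" for p r
    using mult_le_mono1[of "Suc p" n n] that by simp
  show ?thesis
    using assms bound by (simp add: flip_mat_def div_mult_self3 div_less)
qed

text \<open>In multi-index form the flip is a permutation matrix, so every sum against it has at
  most one nonzero term.\<close>

lemma on_factors_flip:
  assumes "k \<in> S" "l \<in> S" "k \<noteq> l" "d k = d l"
  shows "on_factors S d k l (flip_mat (d l)) x y =
    (if x \<in> multi S d \<and> y = x \<circ> transpose k l then 1 else 0)"
proof (cases "x \<in> multi S d \<and> y \<in> multi S d")
  case True
  then have lt: "x k < d l" "x l < d l" "y k < d l" "y l < d l"
    using assms by (auto simp: multi_def PiE_iff)
  have "y = x \<circ> transpose k l \<longleftrightarrow> (\<forall>s\<in>S. y s = (x \<circ> transpose k l) s)"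
    using True multi_eqI multi_transpose_iff[of k S l d, OF assms(1,2,4)] by blast
  also have "\<dots> \<longleftrightarrow> (\<forall>s\<in>S - {k, l}. x s = y s) \<and> x k = y l \<and> x l = y k"
    using assms by (auto simp: transpose_def)
  finally show ?thesis
    unfolding on_factors_def flip_mat_entry[OF lt] using True by auto
next
  case False
  then show ?thesis
    using multi_transpose_iff[of k S l d, OF assms(1,2,4)] by (auto simp: on_factors_def)
qed

text \<open>This is A P = P (P A P): both sides have the entry
  \<open>A x (y \<circ> transpose k l)\<close>.\<close>

lemma comp_flip:
  assumes "finite S" "k \<in> S" "l \<in> S" "k \<noteq> l" "d k = d l" "supported S d A"
  shows "op_comp S d A (on_factors S d k l (flip_mat (d l))) =
         op_comp S d (on_factors S d k l (flip_mat (d l))) (swap_op k l A)"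
proof (rule supported_eqI)
  fix x y
  assume xy: "x \<in> multi S d" "y \<in> multi S d"
  note tr = multi_transpose_iff[of k S l d, OF assms(2,3,5)]
  have "op_comp S d A (on_factors S d k l (flip_mat (d l))) x y =
      (\<Sum>w\<in>multi S d. if w = y \<circ> transpose k l then A x (y \<circ> transpose k l) else 0)"
    unfolding op_comp_def on_factors_flip[OF assms(2-5)]
    by (intro sum.cong) (auto simp: comp_assoc)
  also have "\<dots> = A x (y \<circ> transpose k l)"
    using xy tr finite_multi[OF assms(1)] by simp
  also have "\<dots> = (\<Sum>w\<in>multi S d. if w = x \<circ> transpose k l then A x (y \<circ> transpose k l) else 0)"
    using xy tr finite_multi[OF assms(1)] by simp
  also have "\<dots> = op_comp S d (on_factors S d k l (flip_mat (d l))) (swap_op k l A) x y"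
    unfolding op_comp_def on_factors_flip[OF assms(2-5)] swap_op_def
    by (intro sum.cong) (auto simp: comp_assoc xy)
  finally show "op_comp S d A (on_factors S d k l (flip_mat (d l))) x y =
    op_comp S d (on_factors S d k l (flip_mat (d l))) (swap_op k l A) x y" .
qed (use assms in \<open>auto intro!: supported_comp supported_on_factors supported_swap_op\<close>)

section \<open>Adjoining an auxiliary factor\<close>

text \<open>The operator A \<otimes> id, with the identity in the factor \<open>a\<close>.
  Multi-indices are extensional, so forgetting the coordinate at \<open>a\<close> is
  \<open>restrict\<close>, and adding it is a function update.\<close>

definition lift_op :: "nat \<Rightarrow> nat set \<Rightarrow> (nat \<Rightarrow> nat) \<Rightarrow> tensor_op \<Rightarrow> tensor_op" where
  "lift_op a S d A x y =
     (if x \<in> multi (insert a S) d \<and> y \<in> multi (insert a S) d \<and> x a = y a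
      then A (restrict x S) (restrict y S) else 0)"

lemma supported_lift_op: "supported (insert a S) d (lift_op a S d A)"
  by (auto simp: supported_def lift_op_def)

lemma restrict_multi: "x \<in> multi (insert a S) d \<Longrightarrow> restrict x S \<in> multi S d"
  by (auto simp: multi_def PiE_iff)

lemma restrict_upd_multi: "a \<notin> S \<Longrightarrow> x \<in> multi S d \<Longrightarrow> restrict (x(a := c)) S = x"
  by (simp add: multi_def PiE_restrict)

lemma upd_restrict_multi:
  assumes "x \<in> multi (insert a S) d"
  shows "(restrict x S)(a := x a) = x"
proof
  fix s
  show "((restrict x S)(a := x a)) s = x s"
    using assms PiE_arb[of x "insert a S" _ s]
    by (cases "s = a"; cases "s \<in> S") (auto simp: multi_def simp del: restrict_upd)
qed

lemma upd_multi: "x \<in> multi S d \<Longrightarrow> c < d a \<Longrightarrow> x(a := c) \<in> multi (insert a S) d"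
  by (auto simp: multi_def PiE_iff extensional_def)

text \<open>A multi-index on \<open>insert a S\<close> is a pair of its coordinate at
  \<open>a\<close> and a multi-index on \<open>S\<close>.\<close>

lemma sum_multi_insert:
  assumes "a \<notin> S"
  shows "(\<Sum>w\<in>multi (insert a S) d. f w) = (\<Sum>c<d a. \<Sum>w\<in>multi S d. f (w(a := c)))"
proof -
  have "bij_betw (\<lambda>(c, w). w(a := c)) ({..<d a} \<times> multi S d) (multi (insert a S) d)"
  proof (rule bij_betwI[where g = "\<lambda>w. (w a, restrict w S)"])
    show "(\<lambda>(c, w). w(a := c)) \<in> {..<d a} \<times> multi S d \<rightarrow> multi (insert a S) d"
      by (auto intro: upd_multi)
    show "(\<lambda>w. (w a, restrict w S)) \<in> multi (insert a S) d \<rightarrow> {..<d a} \<times> multi S d"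
      by (auto simp: restrict_multi) (simp add: multi_def PiE_iff)
    show "(case (w a, restrict w S) of (c, w) \<Rightarrow> w(a := c)) = w"
      if "w \<in> multi (insert a S) d" for w
      using that by (simp add: upd_restrict_multi del: restrict_upd)
    show "((case p of (c, w) \<Rightarrow> w(a := c)) a, restrict (case p of (c, w) \<Rightarrow> w(a := c)) S) = p"
      if "p \<in> {..<d a} \<times> multi S d" for p
      using that restrict_upd_multi[OF assms] by (auto simp del: restrict_fupd)
  qed
  from sum.reindex_bij_betw[OF this, of f, symmetric] show ?thesis
    by (simp add: sum.cartesian_product split_def)
qed

lemma lift_op_upd:
  assumes "a \<notin> S" "x \<in> multi S d" "y \<in> multi S d" "c < d a" "c' < d a"
  shows "lift_op a S d A (x(a := c)) (y(a := c')) = (if c = c' then A x y else 0)"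
  unfolding lift_op_def restrict_upd_multi[OF assms(1,2)] restrict_upd_multi[OF assms(1,3)]
  using assms(4,5) upd_multi[OF assms(2,4)] upd_multi[OF assms(3,5)] by simp

lemma lift_op_id:
  assumes "a \<notin> S"
  shows "lift_op a S d (op_id S d) = op_id (insert a S) d"
proof (rule supported_eqI)
  fix x y
  assume x: "x \<in> multi (insert a S) d" and y: "y \<in> multi (insert a S) d"
  have "x a = y a \<and> restrict x S = restrict y S \<longleftrightarrow> x = y"
    using upd_restrict_multi[OF x] upd_restrict_multi[OF y] by metis
  then show "lift_op a S d (op_id S d) x y = op_id (insert a S) d x y"
    using x y restrict_multi[OF x] by (auto simp add: lift_op_def op_id_def)
qed (rule supported_lift_op supported_id)+

text \<open>A lift is diagonal in the coordinate at \<open>a\<close>, so only the summand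
  \<open>c' = c\<close> survives. The function \<open>f\<close> stays arbitrary because in the trace
  the lift is multiplied by operators that do move this coordinate.\<close>

lemma sum_lift_left:
  assumes "a \<notin> S" "x \<in> multi S d" "c < d a"
  shows "(\<Sum>w\<in>multi (insert a S) d. lift_op a S d A (x(a := c)) w * f w) =
         (\<Sum>w\<in>multi S d. A x w * f (w(a := c)))"
proof -
  have "(\<Sum>w\<in>multi (insert a S) d. lift_op a S d A (x(a := c)) w * f w) =
      (\<Sum>c'<d a. if c' = c then \<Sum>w\<in>multi S d. A x w * f (w(a := c)) else 0)"
    unfolding sum_multi_insert[OF assms(1)]
    by (intro sum.cong) (use assms in \<open>auto simp: lift_op_upd\<close>)
  then show ?thesis using assms by simp
qed

lemma sum_lift_right:
  assumes "a \<notin> S" "y \<in> multi S d" "c < d a"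
  shows "(\<Sum>w\<in>multi (insert a S) d. f w * lift_op a S d A w (y(a := c))) =
         (\<Sum>w\<in>multi S d. f (w(a := c)) * A w y)"
proof -
  have "(\<Sum>w\<in>multi (insert a S) d. f w * lift_op a S d A w (y(a := c))) =
      (\<Sum>c'<d a. if c' = c then \<Sum>w\<in>multi S d. f (w(a := c)) * A w y else 0)"
    unfolding sum_multi_insert[OF assms(1)]
    by (intro sum.cong) (use assms in \<open>auto simp: lift_op_upd\<close>)
  then show ?thesis using assms by simp
qed

lemma lift_op_comp:
  assumes "a \<notin> S"
  shows "lift_op a S d (op_comp S d A B) =
         op_comp (insert a S) d (lift_op a S d A) (lift_op a S d B)"
proof (rule supported_eqI)
  fix x y
  assume xy: "x \<in> multi (insert a S) d" "y \<in> multi (insert a S) d"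
  define x' y' where "x' = restrict x S" and "y' = restrict y S"
  have xa: "x a < d a" "y a < d a" using xy by (auto simp: multi_def PiE_iff)
  have x': "x' \<in> multi S d" "y' \<in> multi S d"
    using xy by (auto simp: x'_def y'_def restrict_multi)
  have eqs: "x'(a := x a) = x" "y'(a := y a) = y"
    using xy by (simp_all add: x'_def y'_def upd_restrict_multi del: restrict_upd)
  have "op_comp (insert a S) d (lift_op a S d A) (lift_op a S d B) (x'(a := x a)) (y'(a := y a)) =
      lift_op a S d (op_comp S d A B) (x'(a := x a)) (y'(a := y a))"
    using assms xa x' by (simp add: op_comp_def sum_lift_left lift_op_upd)
  then show "lift_op a S d (op_comp S d A B) x y =
      op_comp (insert a S) d (lift_op a S d A) (lift_op a S d B) x y"
    unfolding eqs by simp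
qed (auto intro: supported_lift_op supported_comp)

lemma lift_on_factor:
  assumes "a \<notin> S" "k \<in> S"
  shows "lift_op a S d (on_factor S d k M) = on_factor (insert a S) d k M"
proof (rule supported_eqI)
  fix x y
  assume x: "x \<in> multi (insert a S) d" and y: "y \<in> multi (insert a S) d"
  have "x a = y a \<and> (\<forall>s\<in>S - {k}. restrict x S s = restrict y S s) \<longleftrightarrow>
        (\<forall>s\<in>insert a S - {k}. x s = y s)"
    using assms by auto
  then show "lift_op a S d (on_factor S d k M) x y = on_factor (insert a S) d k M x y"
    unfolding lift_op_def on_factor_def using assms x y restrict_multi[OF x] restrict_multi[OF y]
    by (simp only: restrict_apply' if_True simp_thms) metis
qed (rule supported_lift_op supported_on_factor)+

lemma lift_on_factors:
  assumes "a \<notin> S" "k \<in> S" "l \<in> S"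
  shows "lift_op a S d (on_factors S d k l M) = on_factors (insert a S) d k l M"
proof (rule supported_eqI)
  fix x y
  assume x: "x \<in> multi (insert a S) d" and y: "y \<in> multi (insert a S) d"
  have "x a = y a \<and> (\<forall>s\<in>S - {k, l}. restrict x S s = restrict y S s) \<longleftrightarrow>
        (\<forall>s\<in>insert a S - {k, l}. x s = y s)"
    using assms by auto
  then show "lift_op a S d (on_factors S d k l M) x y = on_factors (insert a S) d k l M x y"
    unfolding lift_op_def on_factors_def using assms x y restrict_multi[OF x] restrict_multi[OF y]
    by (simp only: restrict_apply' if_True simp_thms) metis
qed (rule supported_lift_op supported_on_factors)+

section \<open>The partial trace over the auxiliary factor\<close>

text \<open>The trace is a bimodule map over operators that do not involve \<open>a\<close>. The
  case distinction is there because \<open>A\<close> and \<open>B\<close> are not assumed supported,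
  whereas a partial trace always vanishes off the multi-indices.\<close>

lemma partial_trace_lift:
  assumes "a \<notin> S"
  shows "partial_trace (insert a S) d a
           (op_comp (insert a S) d (lift_op a S d B)
             (op_comp (insert a S) d X (lift_op a S d A))) x y =
         (if x \<in> multi S d \<and> y \<in> multi S d
          then op_comp S d B (op_comp S d (partial_trace (insert a S) d a X) A) x y else 0)"
proof (cases "x \<in> multi S d \<and> y \<in> multi S d")
  case True
  have S: "insert a S - {a} = S" using assms by auto
  have x: "x \<in> multi S d" and y: "y \<in> multi S d" using True by auto
  have "(\<Sum>c<d a. op_comp (insert a S) d (lift_op a S d B)
         (op_comp (insert a S) d X (lift_op a S d A)) (x(a := c)) (y(a := c))) =
      (\<Sum>c<d a. \<Sum>w\<in>multi S d. B x w * (\<Sum>w'\<in>multi S d. X (w(a := c)) (w'(a := c)) * A w' y))"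
  proof (intro sum.cong refl)
    fix c assume "c \<in> {..<d a}"
    then have c: "c < d a" by simp
    have "op_comp (insert a S) d X (lift_op a S d A) w (y(a := c)) =
        (\<Sum>w'\<in>multi S d. X w (w'(a := c)) * A w' y)" for w
      unfolding op_comp_def by (rule sum_lift_right[OF assms y c])
    then show "op_comp (insert a S) d (lift_op a S d B)
        (op_comp (insert a S) d X (lift_op a S d A)) (x(a := c)) (y(a := c)) =
        (\<Sum>w\<in>multi S d. B x w * (\<Sum>w'\<in>multi S d. X (w(a := c)) (w'(a := c)) * A w' y))"
      unfolding op_comp_def[of _ _ "lift_op a S d B"]
      by (simp add: sum_lift_left[OF assms x c])
  qed
  \<comment> \<open>The sum over \<open>c\<close> moves innermost, where it meets only
    \<open>X\<close>: the entries of \<open>A\<close> and \<open>B\<close> are free of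
    \<open>c\<close>.\<close>
  also have "\<dots> = (\<Sum>w\<in>multi S d. \<Sum>c<d a. \<Sum>w'\<in>multi S d.
      B x w * (X (w(a := c)) (w'(a := c)) * A w' y))"
    by (subst sum.swap) (simp add: sum_distrib_left)
  also have "\<dots> = (\<Sum>w\<in>multi S d. \<Sum>w'\<in>multi S d. \<Sum>c<d a.
      B x w * (X (w(a := c)) (w'(a := c)) * A w' y))"
    by (intro sum.cong refl sum.swap)
  also have "\<dots> = op_comp S d B (op_comp S d (partial_trace (insert a S) d a X) A) x y"
    unfolding op_comp_def partial_trace_def S
    by (simp add: sum_distrib_left sum_distrib_right)
  finally show ?thesis
    using True by (simp add: partial_trace_def S)
next
  case False
  have S: "insert a S - {a} = S" using assms by auto
  show ?thesis unfolding partial_trace_def S using False by auto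
qed

text \<open>On the diagonal \<open>x = y\<close>, exactly one value of the traced coordinate
  contributes, namely \<open>c = x l\<close>; it lies in range because
  \<open>d a = d l\<close>.\<close>

lemma partial_trace_flip:
  assumes "a \<notin> S" "l \<in> S" "d a = d l"
  shows "partial_trace (insert a S) d a (on_factors (insert a S) d a l (flip_mat (d l))) = op_id S d"
proof (intro ext)
  fix x y
  have S: "insert a S - {a} = S" using assms by auto
  have al: "a \<noteq> l" using assms by auto
  show "partial_trace (insert a S) d a (on_factors (insert a S) d a l (flip_mat (d l))) x y =
    op_id S d x y"
  proof (cases "x \<in> multi S d \<and> y \<in> multi S d")
    case True
    have lt: "x l < d l" using True assms by (auto simp: multi_def PiE_iff)
    \<comment> \<open>At \<open>a\<close> the equation reads \<open>c = x l\<close>, at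
      \<open>l\<close> it reads \<open>y l = c\<close>, and at every other label it compares
      \<open>x\<close> with \<open>y\<close>.\<close>
    have eq: "y(a := c) = x(a := c) \<circ> transpose a l \<longleftrightarrow> c = x l \<and> x = y" for c
    proof
      assume e: "y(a := c) = x(a := c) \<circ> transpose a l"
      have "c = x l" "y l = c"
        using fun_cong[OF e, of a] fun_cong[OF e, of l] al by auto
      moreover have "x = y"
      proof (rule multi_eqI)
        fix s assume "s \<in> S"
        then show "x s = y s"
          using fun_cong[OF e, of s] \<open>c = x l\<close> \<open>y l = c\<close> assms(1)
          by (cases "s = l") (auto simp: transpose_def split: if_splits)
      qed (use True in auto)
      ultimately show "c = x l \<and> x = y" by simp
    next
      assume "c = x l \<and> x = y"
      then show "y(a := c) = x(a := c) \<circ> transpose a l"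
        using al by (auto simp: transpose_def fun_eq_iff)
    qed
    have "(\<Sum>c<d a. on_factors (insert a S) d a l (flip_mat (d l)) (x(a := c)) (y(a := c))) =
        (\<Sum>c<d a. if c = x l then (if x = y then 1 else 0) else 0)"
      by (intro sum.cong refl, subst on_factors_flip)
        (use assms al True in \<open>auto simp: eq upd_multi\<close>)
    also have "\<dots> = (if x = y then 1 else 0)"
      using lt assms by simp
    finally show ?thesis using True by (simp add: partial_trace_def op_id_def S)
  next
    case False
    then show ?thesis by (auto simp: partial_trace_def op_id_def S)
  qed
qed

text \<open>The combinatorial core, for arbitrary matrices \<open>M i\<close> apart from the flip at
  \<open>j\<close>. In the application \<open>is\<close> is N, ..., j+1 and \<open>ks\<close> is
  j-1, ..., 1; their disjointness supplies the commutation.\<close>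

lemma partial_trace_chain:
  assumes "finite S" "a \<notin> S" "j \<in> S" "d a = d j"
    and "M j = flip_mat (d j)"
    and "set is \<subseteq> S - {j}" "set ks \<subseteq> S - {j}" "set is \<inter> set ks = {}"
  shows "partial_trace (insert a S) d a (op_prod (insert a S) d
           (on_factor (insert a S) d a Q #
            map (\<lambda>i. on_factors (insert a S) d a i (M i)) (is @ j # ks))) =
         op_prod S d (map (\<lambda>i. on_factors S d j i (M i)) ks @
            [on_factor S d j Q] @ map (\<lambda>i. on_factors S d j i (M i)) is)"
    (is "?lhs = ?rhs")
proof -
  let ?T = "insert a S"
  define As Bs where
    "As = on_factor ?T d a Q # map (\<lambda>i. on_factors ?T d a i (M i)) is"
    and "Bs = map (\<lambda>i. on_factors ?T d a i (M i)) ks"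
  \<comment> \<open>Primed lists act on \<open>S\<close> alone, with \<open>j\<close> in place of
    \<open>a\<close>. Exchanging \<open>a\<close> and \<open>j\<close> turns the unprimed lists into
    the lifts of the primed ones.\<close>
  define As' Bs' where
    "As' = on_factor S d j Q # map (\<lambda>i. on_factors S d j i (M i)) is"
    and "Bs' = map (\<lambda>i. on_factors S d j i (M i)) ks"
  define P where "P = on_factors ?T d a j (M j)"
  let ?A = "op_prod ?T d As" and ?B = "op_prod ?T d Bs"
  let ?A' = "op_prod S d As'" and ?B' = "op_prod S d Bs'"
  have aj: "a \<noteq> j" "a \<in> ?T" "j \<in> ?T" and T: "finite ?T" using assms by auto
  have sA: "\<And>X. X \<in> set As \<Longrightarrow> supported ?T d X"
    and sB: "\<And>X. X \<in> set Bs \<Longrightarrow> supported ?T d X"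
    and sA': "\<And>X. X \<in> set As' \<Longrightarrow> supported S d X"
    and sB': "\<And>X. X \<in> set Bs' \<Longrightarrow> supported S d X"
    and sP: "supported ?T d P"
    by (auto simp: As_def Bs_def As'_def Bs'_def P_def supported_on_factor supported_on_factors)
  have fact: "on_factor ?T d a Q # map (\<lambda>i. on_factors ?T d a i (M i)) (is @ j # ks) =
      As @ P # Bs"
    by (simp add: As_def Bs_def P_def)
  have mapA: "map (swap_op a j) As = map (lift_op a S d) As'"
    using assms aj
    by (auto simp: As_def As'_def lift_on_factor lift_on_factors swap_on_factor
        intro!: swap_on_factors)
  have mapB: "map (swap_op a j) Bs = map (lift_op a S d) Bs'"
    using assms aj
    by (auto simp: Bs_def Bs'_def lift_on_factors intro!: swap_on_factors)
  have swap_prod: "swap_op a j (op_prod ?T d Xs) = op_prod ?T d (map (swap_op a j) Xs)"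
    if "\<And>X. X \<in> set Xs \<Longrightarrow> supported ?T d X" for Xs
    by (rule op_prod_map_hom[where h = "swap_op a j" and S = ?T and d = d])
      (use that aj assms(4) in \<open>auto intro!: swap_op_id swap_op_comp\<close>)
  have lift_prod: "lift_op a S d (op_prod S d Xs) = op_prod ?T d (map (lift_op a S d) Xs)"
    if "\<And>X. X \<in> set Xs \<Longrightarrow> supported S d X" for Xs
    by (rule op_prod_map_hom[where h = "lift_op a S d" and S = S and d = d])
      (use that assms(2) in \<open>auto intro!: lift_op_id lift_op_comp\<close>)
  have A: "swap_op a j ?A = lift_op a S d ?A'"
    using swap_prod[of As] lift_prod[of As'] sA sA' mapA by simp
  have B: "swap_op a j ?B = op_prod ?T d (map (swap_op a j) Bs)"
    using sB by (rule swap_prod)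
  have B': "swap_op a j ?B = lift_op a S d ?B'"
    using B lift_prod[of Bs'] sB' mapB by simp
  have flipA: "op_comp ?T d ?A P = op_comp ?T d P (swap_op a j ?A)"
    unfolding P_def assms(5)
    using comp_flip[of ?T a j d ?A] T aj assms(4) sA supported_prod by blast
  have "supported ?T d (swap_op a j ?B)"
    unfolding B' by (rule supported_lift_op)
  then have flipB: "op_comp ?T d (swap_op a j ?B) P = op_comp ?T d P ?B"
    unfolding P_def assms(5)
    using comp_flip[of ?T a j d "swap_op a j ?B"] T aj assms(4)
    by (simp add: swap_op_swap_op)
  have comm: "op_comp ?T d ?A (swap_op a j ?B) = op_comp ?T d (swap_op a j ?B) ?A"
    unfolding B
  proof (rule op_prod_commute[OF T])
    show "supported ?T d X" if "X \<in> set As" for X using that by (rule sA)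
    show "supported ?T d Y" if "Y \<in> set (map (swap_op a j) Bs)" for Y
      using that unfolding mapB by (auto simp: supported_lift_op)
    fix X Y
    assume X: "X \<in> set As" and Y: "Y \<in> set (map (swap_op a j) Bs)"
    \<comment> \<open>\<open>X\<close> acts within \<open>a\<close> and the labels in
      \<open>is\<close>, and \<open>Y\<close> in \<open>j\<close> and one label of
      \<open>ks\<close>. These sets are disjoint since \<open>a \<notin> S\<close> and
      \<open>j\<close> is excluded from \<open>is\<close>.\<close>
    from X obtain U c where U: "local_op ?T d U c X" "U \<subseteq> insert a (set is)"
      by (auto simp: As_def) (use local_on_factor local_on_factors in blast)+
    from Y obtain k where k: "k \<in> set ks" "Y = lift_op a S d (on_factors S d j k (M k))"
      unfolding mapB Bs'_def by auto
    have "k \<in> S" using k(1) assms(7) by auto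
    then have Y': "Y = on_factors ?T d j k (M k)"
      unfolding k(2) by (rule lift_on_factors[OF assms(2,3)])
    show "op_comp ?T d X Y = op_comp ?T d Y X"
      unfolding Y'
      by (rule local_commute[OF T _ _ _ U(1) local_on_factors]) (use U(2) k(1) assms in auto)
  qed
  have prod: "op_prod ?T d (As @ P # Bs) =
      op_comp ?T d (lift_op a S d ?B') (op_comp ?T d P (lift_op a S d ?A'))"
  proof -
    \<comment> \<open>Writing X~ for \<open>swap_op a j X\<close>, the computation is A P B = A B~ P
      = B~ A P = B~ P A~.\<close>
    have "op_prod ?T d (As @ P # Bs) = op_comp ?T d ?A (op_comp ?T d P ?B)"
      by (subst op_prod_append[OF T]) (auto simp: op_prod_Cons sB sP)
    also have "\<dots> = op_comp ?T d (op_comp ?T d ?A (swap_op a j ?B)) P"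
      unfolding flipB[symmetric] op_comp_assoc ..
    also have "\<dots> = op_comp ?T d (swap_op a j ?B) (op_comp ?T d ?A P)"
      unfolding comm op_comp_assoc ..
    finally show ?thesis unfolding flipA A B' .
  qed
  have supp: "supported S d ?A'" "supported S d ?B'"
    using sA' sB' by (auto intro: supported_prod)
  have "?lhs = op_comp S d ?B' ?A'"
  proof (intro ext)
    fix x y
    \<comment> \<open>Support of the product absorbs the case distinction left by
      \<open>partial_trace_lift\<close>.\<close>
    have "supported S d (op_comp S d ?B' ?A')"
      using supp by (intro supported_comp)
    then show "?lhs x y = op_comp S d ?B' ?A' x y"
      unfolding fact unfolding prod unfolding partial_trace_lift[OF assms(2)] P_def assms(5)
        partial_trace_flip[OF assms(2,3,4)] op_comp_id_left[OF assms(1) supp(1)]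
      by (auto simp: supported_def)
  qed
  also have "\<dots> = ?rhs"
    by (subst op_prod_append[OF assms(1), symmetric])
      (auto simp: As'_def Bs'_def supported_on_factor supported_on_factors)
  finally show ?thesis .
qed

section \<open>Normalization at the permutation point\<close>

text \<open>Well-definedness of evaluation: equal fractions satisfy \<open>n * d' = n' * d\<close>
  as polynomials, and this identity is evaluated at \<open>z\<close>.\<close>

lemma rat_value_Fract:
  assumes "poly d z \<noteq> 0"
  shows "rat_value (Fraction_Field.Fract n d) z = poly n z / poly d z"
  unfolding rat_value_def
proof (rule the_equality)
  show "\<exists>n' d'. poly d' z \<noteq> 0 \<and> Fraction_Field.Fract n d = Fraction_Field.Fract n' d' \<and>
      poly n z / poly d z = poly n' z / poly d' z"
    using assms by blast
next
  fix c
  assume "\<exists>n' d'. poly d' z \<noteq> 0 \<and> Fraction_Field.Fract n d = Fraction_Field.Fract n' d' \<and>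
      c = poly n' z / poly d' z"
  then obtain n' d' where *: "poly d' z \<noteq> 0" "c = poly n' z / poly d' z"
    "Fraction_Field.Fract n d = Fraction_Field.Fract n' d'" by blast
  have "d \<noteq> 0" "d' \<noteq> 0" using assms * by auto
  then have "n * d' = n' * d" using * by (simp add: eq_fract)
  then have "poly n z * poly d' z = poly n' z * poly d z" by (metis poly_mult)
  then show "c = poly n z / poly d z"
    unfolding *(2) using assms *(1) by (simp add: frac_eq_eq)
qed

text \<open>These functions form the localization of the polynomial ring at the point
  \<open>z\<close>. The lemmas that follow make \<open>rat_value\<close> a homomorphism on it that
  fixes the constants.\<close>

definition regular_fract :: "ratfun \<Rightarrow> complex \<Rightarrow> bool" where
  "regular_fract f z \<longleftrightarrow> (\<exists>n d. poly d z \<noteq> 0 \<and> f = Fraction_Field.Fract n d)"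

lemma regular_const: "regular_fract (rat_const c) z"
  and rat_value_const: "rat_value (rat_const c) z = c"
  unfolding regular_fract_def rat_const_def
  by (rule exI[of _ "[:c:]"], rule exI[of _ 1], simp) (simp add: rat_value_Fract)

lemma regular_add_mult:
  assumes "regular_fract f z" "regular_fract g z"
  shows "regular_fract (f + g) z" "rat_value (f + g) z = rat_value f z + rat_value g z"
    and "regular_fract (f * g) z" "rat_value (f * g) z = rat_value f z * rat_value g z"
proof -
  obtain n d n' d' where *: "poly d z \<noteq> 0" "f = Fraction_Field.Fract n d"
    "poly d' z \<noteq> 0" "g = Fraction_Field.Fract n' d'"
    using assms unfolding regular_fract_def by blast
  have nz: "poly (d * d') z \<noteq> 0" using * by simp
  have "d \<noteq> 0" "d' \<noteq> 0" using * by auto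
  then have add: "f + g = Fraction_Field.Fract (n * d' + n' * d) (d * d')"
    and mult: "f * g = Fraction_Field.Fract (n * n') (d * d')"
    using * by simp_all
  show "regular_fract (f + g) z" "regular_fract (f * g) z"
    using nz add mult unfolding regular_fract_def by blast+
  show "rat_value (f + g) z = rat_value f z + rat_value g z"
    "rat_value (f * g) z = rat_value f z * rat_value g z"
    unfolding add mult using * nz by (simp_all add: rat_value_Fract field_simps)
qed

lemma regular_sum:
  assumes "\<And>i. i \<in> I \<Longrightarrow> regular_fract (f i) z"
  shows "regular_fract (\<Sum>i\<in>I. f i) z \<and> rat_value (\<Sum>i\<in>I. f i) z = (\<Sum>i\<in>I. rat_value (f i) z)"
proof -
  have zero: "regular_fract 0 z" "rat_value 0 z = 0"
    using regular_const[of 0 z] rat_value_const[of 0 z]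
    by (simp_all add: rat_const_def flip: Zero_fract_def)
  show ?thesis
    using assms
    by (induction I rule: infinite_finite_induct) (simp_all add: zero regular_add_mult)
qed

text \<open>Evaluation is applied to each coordinate of an identity over the rational functions;
  \<open>w\<close> and \<open>y\<close> have constant entries, so only \<open>R\<close>
  changes.\<close>

lemma value_at_mult_vec:
  assumes "R \<in> carrier_mat m n" "w \<in> carrier_vec n" "y \<in> carrier_vec m" "regular_at R z"
    and "R *\<^sub>v map_vec rat_const w = map_vec rat_const y"
  shows "value_at R z *\<^sub>v w = y"
proof (rule eq_vecI)
  fix a assume "a < dim_vec y"
  then have a: "a < m" using assms by simp
  have reg: "regular_fract (R $$ (a, b)) z" if "b < n" for b
    using assms(1,4) a that unfolding regular_at_def regular_fract_def by auto
  have "rat_const (y $ a) = (R *\<^sub>v map_vec rat_const w) $ a"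
    using assms a by simp
  also have "\<dots> = (\<Sum>b = 0..<n. R $$ (a, b) * rat_const (w $ b))"
    using assms(1-3) a by (simp add: scalar_prod_def)
  finally have "rat_value (rat_const (y $ a)) z =
      rat_value (\<Sum>b = 0..<n. R $$ (a, b) * rat_const (w $ b)) z" by simp
  also have "\<dots> = (\<Sum>b = 0..<n. rat_value (R $$ (a, b) * rat_const (w $ b)) z)"
    by (intro regular_sum[THEN conjunct2] regular_add_mult reg regular_const) simp
  also have "\<dots> = (\<Sum>b = 0..<n. rat_value (R $$ (a, b)) z * w $ b)"
    by (intro sum.cong refl) (simp add: regular_add_mult reg regular_const rat_value_const)
  also have "\<dots> = (value_at R z *\<^sub>v w) $ a"
    using assms(1-3) a by (simp add: value_at_def scalar_prod_def)
  finally show "(value_at R z *\<^sub>v w) $ a = y $ a"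
    by (simp add: rat_value_const)
qed (use assms in \<open>simp add: value_at_def\<close>)

section \<open>The scalar at the permutation point\<close>

lemma flip_mat_kron_vec:
  assumes "x \<in> carrier_vec n" "y \<in> carrier_vec n"
  shows "flip_mat n *\<^sub>v kron_vec x y = kron_vec y x"
proof (rule eq_vecI)
  fix a assume "a < dim_vec (kron_vec y x)"
  then have a: "a < n * n" using assms by (simp add: kron_vec_def)
  then have n: "n > 0" by (cases n) auto
  have lt: "a div n < n" "a mod n < n"
    using a n by (auto simp: less_mult_imp_div_less)
  \<comment> \<open>The index \<open>a\<close> with its two base-\<open>n\<close> digits exchanged:
    the only column where row \<open>a\<close> of the flip is nonzero.\<close>
  define b where "b = (a mod n) * n + a div n"
  have bn: "b < n * n"
    unfolding b_def using mult_le_mono1[of "Suc (a mod n)" n n] lt by simp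
  have b: "b div n = a mod n" "b mod n = a div n"
    using lt n by (simp_all add: b_def)
  have entry: "flip_mat n $$ (a, b') = (if b' = b then 1 else 0)" if "b' < n * n" for b'
    using a that b unfolding flip_mat_def by simp (metis b_def div_mult_mod_eq)
  have "(flip_mat n *\<^sub>v kron_vec x y) $ a =
      (\<Sum>b' = 0..<n * n. flip_mat n $$ (a, b') * kron_vec x y $ b')"
    using a assms by (simp add: flip_mat_def kron_vec_def scalar_prod_def)
  also have "\<dots> = (\<Sum>b' = 0..<n * n. if b' = b then kron_vec x y $ b else 0)"
    by (intro sum.cong refl) (simp add: entry)
  also have "\<dots> = kron_vec y x $ a"
    using a bn b assms by (simp add: kron_vec_def)
  finally show "(flip_mat n *\<^sub>v kron_vec x y) $ a = kron_vec y x $ a" .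
qed (use assms in \<open>auto simp: flip_mat_def kron_vec_def\<close>)

text \<open>If \<open>x $ i \<noteq> 0\<close>, the diagonal coordinate \<open>i * n + i\<close>
  holds its square, which is nonzero.\<close>

lemma kron_vec_nonzero:
  fixes x :: "complex vec"
  assumes "x \<in> carrier_vec n" "x \<noteq> 0\<^sub>v n"
  shows "\<exists>a < n * n. kron_vec x x $ a \<noteq> 0"
proof -
  obtain i where i: "i < n" "x $ i \<noteq> 0"
    using assms by (metis carrier_vecD eq_vecI index_zero_vec)
  have "i * n + i < n * n" using mult_le_mono1[of "Suc i" n n] i by simp
  then show ?thesis
    using i assms(1) by (intro exI[of _ "i * n + i"]) (simp add: kron_vec_def div_mult_self3)
qed

text \<open>The permutation fixes \<open>v \<otimes> v\<close>, so the normalization forces the scalar to be \<open>1\<close>.\<close>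

lemma normalized_R_matrix_flip:
  assumes "normalized_R_matrix g V v V v R" "v \<in> carrier_vec (rdim V)" "v \<noteq> 0\<^sub>v (rdim V)"
    and "regular_at R z" "value_at R z = c \<cdot>\<^sub>m flip_mat (rdim V)"
  shows "value_at R z = flip_mat (rdim V)"
proof -
  let ?n = "rdim V"
  have w: "kron_vec v v \<in> carrier_vec (?n * ?n)"
    using carrier_vecD[OF assms(2)] by (intro carrier_vecI) (simp add: kron_vec_def)
  have F: "flip_mat ?n \<in> carrier_mat (?n * ?n) (?n * ?n)" by (simp add: flip_mat_def)
  have R: "R \<in> carrier_mat (?n * ?n) (?n * ?n)"
    "R *\<^sub>v map_vec rat_const (kron_vec v v) = map_vec rat_const (kron_vec v v)"
    using assms(1) unfolding normalized_R_matrix_def by blast+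
  have "c \<cdot>\<^sub>v kron_vec v v = c \<cdot>\<^sub>v (flip_mat ?n *\<^sub>v kron_vec v v)"
    by (simp only: flip_mat_kron_vec[OF assms(2,2)])
  also have "\<dots> = value_at R z *\<^sub>v kron_vec v v"
    unfolding assms(5) using F w
    by (intro eq_vecI) (auto simp: scalar_prod_def sum_distrib_left mult.assoc)
  also have "\<dots> = kron_vec v v"
    by (rule value_at_mult_vec[OF R(1) w w assms(4) R(2)])
  finally have "c \<cdot>\<^sub>v kron_vec v v = kron_vec v v" .
  moreover obtain a where a: "a < ?n * ?n" "kron_vec v v $ a \<noteq> 0"
    using kron_vec_nonzero[OF assms(2,3)] by blast
  ultimately have "c * kron_vec v v $ a = kron_vec v v $ a"
    using carrier_vecD[OF w] by (metis index_smult_vec(1))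
  then have "c = 1" using a by simp
  then show ?thesis unfolding assms(5) by (intro eq_matI) simp_all
qed

section \<open>The qKZ operators at the critical level\<close>

theorem proposition10p1:
  fixes g :: cartan_datum and q :: complex
    and N j :: nat
    and V :: "nat \<Rightarrow> complex qrep"
    and v :: "nat \<Rightarrow> complex vec"
    and z :: "nat \<Rightarrow> complex"
    and u :: "(nat \<Rightarrow> int) \<Rightarrow> complex"
    and R :: "complex qrep \<Rightarrow> complex qrep \<Rightarrow> ratfun mat"
  assumes "simple_lie g"
    and "q \<noteq> 0" and "\<And>n :: nat. n > 0 \<Longrightarrow> q ^ n \<noteq> 1"
    and "\<And>i. i \<in> {1..N} \<Longrightarrow> irreducible_rep g q (V i)"
    and "\<And>i. i \<in> {1..N} \<Longrightarrow> highest_weight_vector g q (V i) (v i)"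
    and "\<And>i. i \<in> {1..N} \<Longrightarrow> z i \<noteq> 0"
    and "u \<in> cartan_subgroup g"
    and "j \<in> {1..N}"
    and "\<And>i. i \<in> {1..N} \<Longrightarrow> normalized_R_matrix g (V j) (v j) (V i) (v i) (R (V j) (V i))"
    and "\<And>i. i \<in> {1..N} \<Longrightarrow> regular_at (R (V j) (V i)) (z j / z i)"
    and "\<exists>c. value_at (R (V j) (V j)) 1 = c \<cdot>\<^sub>m flip_mat (rdim (V j))"
  shows "qKZ_operator g q R N V z u j 1 = transfer_matrix g q R N V z (V j) (z j) u"
proof -
  \<comment> \<open>Label 0 is the auxiliary copy of \<open>V j\<close>. The override is needed
    because the family \<open>V\<close> is unconstrained at 0.\<close>
  define d where "d = (\<lambda>k. rdim (V k))(0 := rdim (V j))"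
  define M where "M = (\<lambda>i. value_at (R (V j) (V i)) (z j / z i))"
  let ?S = "{1..N}"
  have j: "1 \<le> j" "j \<le> N" using assms(8) by auto
  have Mj: "M j = flip_mat (d j)"
  proof -
    obtain c where c: "value_at (R (V j) (V j)) 1 = c \<cdot>\<^sub>m flip_mat (rdim (V j))"
      using assms(11) by blast
    have "v j \<in> carrier_vec (rdim (V j))" "v j \<noteq> 0\<^sub>v (rdim (V j))"
      using assms(5)[OF assms(8)] by (auto simp: highest_weight_vector_def weight_vector_def)
    \<comment> \<open>The ratio \<open>z j / z j\<close> is 1 because \<open>z j \<noteq> 0\<close>,
      so regularity at the general argument includes regularity at 1.\<close>
    moreover have "regular_at (R (V j) (V j)) 1"
      using assms(10)[OF assms(8)] assms(6)[OF assms(8)] by simp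
    ultimately show ?thesis
      using normalized_R_matrix_flip[OF assms(9)[OF assms(8)] _ _ _ c] j assms(6)[OF assms(8)]
      by (simp add: M_def d_def)
  qed
  have M: "value_at (R (V j) (V i)) (z j / z i) = M i" for i
    by (simp add: M_def)
  have insert: "insert 0 ?S = {0..N}" by auto
  \<comment> \<open>The factors are listed in decreasing order of label, and the list is cut at
    \<open>j\<close>, where the permutation sits.\<close>
  have upt: "rev [1..<Suc N] = rev [Suc j..<Suc N] @ j # rev [1..<j]"
  proof -
    have "[1..<Suc N] = [1..<j] @ [j..<Suc N]"
      using j upt_add_eq_append[of 1 j "Suc N - j"] by simp
    then show ?thesis using j by (simp add: upt_conv_Cons del: upt_Suc)
  qed
  have d: "d k = rdim (V k)" if "k \<in> ?S" for k
    using that by (simp add: d_def)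
  have "transfer_matrix g q R N V z (V j) (z j) u =
      op_prod ?S d (map (\<lambda>i. on_factors ?S d j i (M i)) (rev [1..<j]) @
        [on_factor ?S d j (cartan_action g q u (V j))] @
        map (\<lambda>i. on_factors ?S d j i (M i)) (rev [Suc j..<Suc N]))"
    unfolding transfer_matrix_def Let_def d_def[symmetric] upt M insert[symmetric]
    by (rule partial_trace_chain) (use j Mj in \<open>auto simp: d_def\<close>)
  moreover have "op_prod ?S d = op_prod ?S (\<lambda>k. rdim (V k))"
    by (rule op_prod_dim_cong) (rule d)
  moreover have "on_factor ?S d = on_factor ?S (\<lambda>k. rdim (V k))"
    by (rule on_factor_dim_cong) (rule d)
  moreover have "map (\<lambda>i. on_factors ?S d j i (M i)) xs =
      map (\<lambda>i. on_factors ?S (\<lambda>k. rdim (V k)) j i (M i)) xs" if "set xs \<subseteq> ?S" for xs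
  proof (rule map_cong[OF refl])
    fix i assume "i \<in> set xs"
    then have "i \<in> ?S" using that by blast
    with d have "on_factors ?S d j i = on_factors ?S (\<lambda>k. rdim (V k)) j i"
      by (rule on_factors_dim_cong)
    then show "on_factors ?S d j i (M i) = on_factors ?S (\<lambda>k. rdim (V k)) j i (M i)"
      by simp
  qed
  moreover have "set (rev [1..<j]) \<subseteq> ?S" "set (rev [Suc j..<Suc N]) \<subseteq> ?S"
    using j by auto
  ultimately show ?thesis
    \<comment> \<open>At \<open>p = 1\<close> the arguments \<open>p * z j / z i\<close> for
      \<open>i < j\<close> become \<open>z j / z i\<close>, so both halves of the qKZ operator use
      the same matrices \<open>M i\<close>.\<close>
    by (simp only: qKZ_operator_def Let_def mult_1_left M)
qed

end
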